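(* For every integer $n\ge 1$ there is a bipartite cubic graph of order $4n+2$ with exactly $2^n$ edge-Kempe equivalence classes of $3$-edge-colorings.
   Context: Graphs are finite, simple and undirected; the order of a graph is its number of vertices, and a cubic graph is a $3$-regular graph. A $3$-edge-coloring of a cubic graph is a partition of its edge set into $3$ (unlabeled) color classes such that no two adjacent edges are in the same class. Given a $3$-edge-coloring of a cubic graph, the union of any two of its color classes is a disjoint union of cycles of even length, whose edges alternate between the two colors; an edge-Kempe switch interchanges the two colors along one such cycle, yielding another $3$-edge-coloring. Two $3$-edge-colorings of the same graph are edge-Kempe equivalent if one can be obtained from the other by a (possibly empty) finite sequence of edge-Kempe switches; the equivalence classes of this relation are the edge-Kempe equivalence classes (automorphisms of the graph are not used to identify colorings). *)

theory Defs
  imports Main "HOL-Library.Disjoint_Sets"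
begin

definition simple_graph :: "'a set \<Rightarrow> 'a set set \<Rightarrow> bool" where
  "simple_graph V E \<longleftrightarrow> finite V \<and> (\<forall>e\<in>E. e \<subseteq> V \<and> card e = 2)"

definition cubic :: "'a set \<Rightarrow> 'a set set \<Rightarrow> bool" where
  "cubic V E \<longleftrightarrow> (\<forall>v\<in>V. card {e \<in> E. v \<in> e} = 3)"

definition bipartite :: "'a set \<Rightarrow> 'a set set \<Rightarrow> bool" where
  "bipartite V E \<longleftrightarrow>
     (\<exists>X Y. X \<union> Y = V \<and> X \<inter> Y = {} \<and> (\<forall>e\<in>E. \<exists>x\<in>X. \<exists>y\<in>Y. e = {x, y}))"

text \<open>Colors are unlabeled: a coloring is the partition of the edge set into its color classes.
  \<^const>\<open>partition_on\<close> asks for nonempty classes. This is no restriction for a cubic graph with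
  at least one vertex, since every vertex then meets all three classes.\<close>

definition three_edge_colorings :: "'a set set \<Rightarrow> 'a set set set set" where
  "three_edge_colorings E = {P. partition_on E P \<and> card P = 3 \<and> (\<forall>A\<in>P. pairwise disjnt A)}"

definition cycle_edges :: "'a list \<Rightarrow> 'a set set" where
  "cycle_edges vs = {{vs ! i, vs ! (Suc i mod length vs)} | i. i < length vs}"

definition is_cycle :: "'a set set \<Rightarrow> bool" where
  "is_cycle C \<longleftrightarrow> (\<exists>vs. 3 \<le> length vs \<and> distinct vs \<and> C = cycle_edges vs)"

text \<open>Every vertex lies on at most two edges of \<open>A \<union> B\<close>, so a cycle contained in
  \<open>A \<union> B\<close> is a whole connected component of it (see \<open>cycle_closed\<close> below).\<close>

definition kempe_switch :: "'a set set \<Rightarrow> ('a set set set \<times> 'a set set set) set" where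
  "kempe_switch E = {(P, Q). P \<in> three_edge_colorings E \<and>
     (\<exists>A B C. A \<in> P \<and> B \<in> P \<and> A \<noteq> B \<and> is_cycle C \<and> C \<subseteq> A \<union> B \<and>
        Q = (P - {A, B}) \<union> {(A - C) \<union> (B \<inter> C), (B - C) \<union> (A \<inter> C)})}"

definition kempe_equiv :: "'a set set \<Rightarrow> ('a set set set \<times> 'a set set set) set" where
  "kempe_equiv E = {(P, Q). P \<in> three_edge_colorings E \<and> Q \<in> three_edge_colorings E \<and>
     (P, Q) \<in> (kempe_switch E)\<^sup>*}"

definition kempe_classes :: "'a set set \<Rightarrow> 'a set set set set set" where
  "kempe_classes E = three_edge_colorings E // kempe_equiv E"

lemma cycle_two_edges:
  assumes "is_cycle C" "e \<in> C" "v \<in> e"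
  obtains g h where "g \<in> C" "h \<in> C" "g \<noteq> h" "v \<in> g" "v \<in> h"
proof -
  obtain vs where vs: "3 \<le> length vs" "distinct vs" "C = cycle_edges vs"
    using assms(1) unfolding is_cycle_def by blast
  let ?n = "length vs"
  obtain i where i: "i < ?n" "v = vs ! i"
  proof -
    obtain i where i: "i < ?n" "e = {vs ! i, vs ! (Suc i mod ?n)}"
      using assms(2) vs(3) unfolding cycle_edges_def by blast
    have "Suc i mod ?n < ?n" using i(1) by (intro mod_less_divisor) linarith
    then show ?thesis using that i assms(3) by blast
  qed
  define j where "j = (if i = 0 then ?n - 1 else i - 1)"
  define k where "k = Suc i mod ?n"
  have j: "j < ?n" "Suc j mod ?n = i" using i(1) vs(1) unfolding j_def by auto
  have k: "k < ?n" unfolding k_def using vs(1) by (intro mod_less_divisor) linarith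
  have "k = (if Suc i = ?n then 0 else Suc i)" using i(1) unfolding k_def by auto
  then have "j \<noteq> k" "i \<noteq> j" "i \<noteq> k" using i(1) vs(1) unfolding j_def by (auto split: if_splits)
  then have "vs ! j \<noteq> vs ! k" "vs ! i \<noteq> vs ! j" "vs ! i \<noteq> vs ! k"
    using vs(2) i(1) j(1) k by (simp_all add: nth_eq_iff_index_eq)
  then have ne: "{vs ! i, vs ! k} \<noteq> {vs ! j, vs ! i}" by (auto simp: doubleton_eq_iff)
  have "{vs ! i, vs ! k} \<in> C" using vs(3) i k_def unfolding cycle_edges_def by blast
  moreover have "{vs ! j, vs ! i} \<in> C" using vs(3) j unfolding cycle_edges_def by blast
  ultimately show ?thesis using that[OF _ _ ne] i by blast
qed

lemma cycle_alternates:
  assumes "is_cycle C" "C \<subseteq> A \<union> B" "pairwise disjnt A" "pairwise disjnt B" "e \<in> C" "v \<in> e"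
  obtains a b where "a \<in> A \<inter> C" "b \<in> B \<inter> C" "v \<in> a" "v \<in> b"
proof -
  obtain g h where gh: "g \<in> C" "h \<in> C" "g \<noteq> h" "v \<in> g" "v \<in> h"
    using cycle_two_edges[OF assms(1,5,6)] .
  have "\<not> (g \<in> A \<and> h \<in> A)" "\<not> (g \<in> B \<and> h \<in> B)"
    using pairwiseD[OF assms(3), of g h] pairwiseD[OF assms(4), of g h] gh(3-5)
    unfolding disjnt_def by blast+
  then have "g \<in> A \<inter> C \<and> h \<in> B \<inter> C \<or> h \<in> A \<inter> C \<and> g \<in> B \<inter> C"
    using gh(1,2) assms(2) by blast
  then show ?thesis using that gh(4,5) by metis
qed

lemma cycle_closed:
  assumes "is_cycle C" "C \<subseteq> A \<union> B" "pairwise disjnt A" "pairwise disjnt B"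
    and "e \<in> C" "f \<in> A \<union> B" "e \<inter> f \<noteq> {}"
  shows "f \<in> C"
proof -
  obtain v where v: "v \<in> e" "v \<in> f" using assms(7) by blast
  obtain a b where ab: "a \<in> A \<inter> C" "b \<in> B \<inter> C" "v \<in> a" "v \<in> b"
    using cycle_alternates[OF assms(1-5) v(1)] .
  have "f = a" if "f \<in> A"
    using pairwiseD[OF assms(3), of f a] that v(2) ab unfolding disjnt_def by blast
  moreover have "f = b" if "f \<in> B"
    using pairwiseD[OF assms(4), of f b] that v(2) ab unfolding disjnt_def by blast
  ultimately show ?thesis using assms(6) ab by blast
qed

lemma cycle_nonempty:
  assumes "is_cycle C" shows "\<exists>e v. e \<in> C \<and> v \<in> e"
proof -
  obtain vs where vs: "3 \<le> length vs" "C = cycle_edges vs"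
    using assms unfolding is_cycle_def by blast
  then have "{vs ! 0, vs ! (Suc 0 mod length vs)} \<in> C"
    unfolding cycle_edges_def by (auto intro!: exI[of _ 0])
  then show ?thesis by blast
qed

lemma kempe_switch_sym_coloring:
  assumes "(P, Q) \<in> kempe_switch E"
  shows "Q \<in> three_edge_colorings E" "(Q, P) \<in> kempe_switch E"
proof -
  obtain A B C where *: "A \<in> P" "B \<in> P" "A \<noteq> B" "is_cycle C" "C \<subseteq> A \<union> B"
    and Q: "Q = (P - {A, B}) \<union> {(A - C) \<union> (B \<inter> C), (B - C) \<union> (A \<inter> C)}"
    and P: "P \<in> three_edge_colorings E"
    using assms unfolding kempe_switch_def by blast
  have part: "partition_on E P" and c3: "card P = 3" and m: "\<And>D. D \<in> P \<Longrightarrow> pairwise disjnt D"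
    using P unfolding three_edge_colorings_def by auto
  define A' where "A' = (A - C) \<union> (B \<inter> C)"
  define B' where "B' = (B - C) \<union> (A \<inter> C)"
  have dj: "D \<inter> D' = {}" if "D \<in> P" "D' \<in> P" "D \<noteq> D'" for D D'
    using disjointD[OF partition_onD2[OF part]] that by simp
  have AB: "A \<inter> B = {}" using dj *(1-3) by simp
  obtain e v where ev: "e \<in> C" "v \<in> e" using cycle_nonempty[OF *(4)] by blast
  obtain a b where ab: "a \<in> A \<inter> C" "b \<in> B \<inter> C"
    using cycle_alternates[OF *(4,5) m[OF *(1)] m[OF *(2)] ev] by blast
  have un: "A' \<union> B' = A \<union> B" and AB': "A' \<inter> B' = {}" using AB unfolding A'_def B'_def by blast+
  have ne: "A' \<noteq> {}" "B' \<noteq> {}" using ab unfolding A'_def B'_def by blast+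
  have out: "D \<inter> (A \<union> B) = {}" "D \<noteq> {}" if "D \<in> P - {A, B}" for D
    using that dj[of D A] dj[of D B] *(1,2) partition_onD3[OF part] by (auto simp: Int_Un_distrib)
  have nin: "A' \<notin> P - {A, B}" "B' \<notin> P - {A, B}"
    using out(1)[of A'] out(1)[of B'] ne un[symmetric] by auto
  have Q': "Q = (P - {A, B}) \<union> {A', B'}" using Q unfolding A'_def B'_def .
  have "finite P" using c3 by (metis card.infinite zero_neq_numeral)
  have "card (P - {A, B}) = 1" using card_Diff_subset[of "{A, B}" P] c3 *(1-3) by simp
  have "A' \<noteq> B'" using AB' ne by blast
  then have "card {A', B'} = 2" by simp
  moreover have "(P - {A, B}) \<inter> {A', B'} = {}" using nin by blast
  ultimately have card: "card Q = 3"
    using card_Un_disjoint[of "P - {A, B}" "{A', B'}"] \<open>finite P\<close> \<open>card (P - {A, B}) = 1\<close>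
    unfolding Q' by simp
  have U: "\<Union>Q = E"
  proof -
    have "\<Union>Q = \<Union>(P - {A, B}) \<union> (A \<union> B)" unfolding Q' using un by auto
    also have "\<dots> = \<Union>P" using * by auto
    finally show ?thesis using part unfolding partition_on_def by auto
  qed
  have oA: "D \<inter> A' = {}" "A' \<inter> D = {}" "D \<inter> B' = {}" "B' \<inter> D = {}" if "D \<in> P - {A, B}" for D
    using out(1)[OF that] unfolding un[symmetric] by auto
  have "D \<inter> D' = {}" if "D \<in> P - {A, B}" "D' \<in> P - {A, B}" "D \<noteq> D'" for D D'
    using dj[of D D'] that by blast
  then have "disjoint Q"
    unfolding Q' disjoint_def using AB' oA by (simp add: ball_Un Int_commute)
  then have pq: "partition_on E Q"
    using U ne partition_onD3[OF part] by (intro partition_onI) (auto simp: Q' disjointD disjnt_def)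
  have cl: "f \<in> C" if "e \<in> C" "f \<in> A \<union> B" "e \<inter> f \<noteq> {}" for e f
    using cycle_closed[OF *(4,5) m[OF *(1)] m[OF *(2)] that] .
  have sw: "pairwise disjnt ((X - C) \<union> (Y \<inter> C))"
    if "X \<subseteq> A \<union> B" "Y \<subseteq> A \<union> B" "pairwise disjnt X" "pairwise disjnt Y" for X Y
  proof (rule pairwiseI)
    fix f g assume fg: "f \<in> (X - C) \<union> (Y \<inter> C)" "g \<in> (X - C) \<union> (Y \<inter> C)" "f \<noteq> g"
    have "f \<in> A \<union> B" "g \<in> A \<union> B" using fg that(1,2) by blast+
    then have "f \<inter> g \<noteq> {} \<Longrightarrow> f \<in> C \<longleftrightarrow> g \<in> C" using cl[of f g] cl[of g f] by (metis Int_commute)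
    then show "disjnt f g"
      using fg pairwiseD[OF that(3), of f g] pairwiseD[OF that(4), of f g]
      unfolding disjnt_def by auto
  qed
  have "pairwise disjnt A'" "pairwise disjnt B'"
    unfolding A'_def B'_def using m[OF *(1)] m[OF *(2)] by (auto intro!: sw)
  then show col: "Q \<in> three_edge_colorings E"
    using pq card m unfolding three_edge_colorings_def Q' by auto
  have "P = (Q - {A', B'}) \<union> {(A' - C) \<union> (B' \<inter> C), (B' - C) \<union> (A' \<inter> C)}"
  proof -
    have "Q - {A', B'} = P - {A, B}" using nin unfolding Q' by blast
    moreover have "(A' - C) \<union> (B' \<inter> C) = A" "(B' - C) \<union> (A' \<inter> C) = B"
      using AB unfolding A'_def B'_def by blast+
    ultimately show ?thesis using * by auto
  qed
  moreover have "A' \<in> Q" "B' \<in> Q" "A' \<noteq> B'" "C \<subseteq> A' \<union> B'"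
    using AB' ne *(5) un unfolding Q' by auto
  ultimately show "(Q, P) \<in> kempe_switch E"
    using col *(4) unfolding kempe_switch_def by blast
qed

lemma equiv_kempe_equiv: "equiv (three_edge_colorings E) (kempe_equiv E)"
proof (rule equivI)
  have "sym (kempe_switch E)" using kempe_switch_sym_coloring(2) by (auto simp: sym_def)
  then show "sym (kempe_equiv E)"
    using sym_rtrancl[of "kempe_switch E"] unfolding sym_def kempe_equiv_def by blast
qed (auto simp: kempe_equiv_def refl_on_def trans_def)

end

theory Submission imports Defs begin

text \<open>Take three parallel paths with \<open>n\<close> inner vertices each, joined at both ends, and for every
  level add a hub adjacent to the three inner vertices of that level; for \<open>n = 1\<close> this is
  \<open>K\<^sub>3\<^sub>,\<^sub>3\<close>. The path edges entering a level see three distinct colors, and the colors at the hub are a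
  derangement of them, so passing a level rotates the three colors one way or the other. A coloring
  is thus a free choice of one rotation per level, which gives \<open>2 ^ n\<close> colorings. On the other
  hand, the union of any two color classes is connected, so a Kempe switch just exchanges two
  unlabeled classes and changes nothing: every equivalence class is a singleton.\<close>

section \<open>The graph, with symbolic names for its edges\<close>

datatype link = Path nat nat | Rung nat nat

definition vert :: "nat \<Rightarrow> nat \<Rightarrow> nat \<Rightarrow> nat" where
  "vert n k i = (if i = 0 \<or> i = Suc n then 4 * i else 4 * i + Suc k)"

definition hub :: "nat \<Rightarrow> nat" where
  "hub i = 4 * Suc i"

text \<open>\<open>vert n k i\<close> is the \<open>i\<close>-th vertex on path \<open>k < 3\<close>; the ends \<open>i = 0\<close> and \<open>i = Suc n\<close> do not
  depend on \<open>k\<close>. \<open>hub i\<close> is the hub of level \<open>Suc i\<close>.\<close>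

definition verts :: "nat \<Rightarrow> nat set" where
  "verts n = insert 0 {4..4 * n + 4}"

text \<open>A rung is attached at position \<open>Suc i\<close> but carries the index of the path
  edge \<open>Path k i\<close> that enters its level, so that one induction step on \<open>i\<close>
  treats the incoming edges, the rungs and the outgoing edges \<open>Path k (Suc i)\<close>
  together.\<close>

primrec ends :: "nat \<Rightarrow> link \<Rightarrow> nat set" where
  "ends n (Path k i) = {vert n k i, vert n k (Suc i)}"
| "ends n (Rung k i) = {hub i, vert n k (Suc i)}"

definition links :: "nat \<Rightarrow> link set" where
  "links n = {Path k i | k i. k < 3 \<and> i \<le> n} \<union> {Rung k i | k i. k < 3 \<and> i < n}"

definition edges :: "nat \<Rightarrow> nat set set" where
  "edges n = ends n ` links n"

definition star :: "nat \<Rightarrow> nat \<Rightarrow> link set" where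
  "star n v = {x \<in> links n. v \<in> ends n x}"

lemma Path_in_links [simp]: "Path k i \<in> links n \<longleftrightarrow> k < 3 \<and> i \<le> n"
  and Rung_in_links [simp]: "Rung k i \<in> links n \<longleftrightarrow> k < 3 \<and> i < n"
  by (auto simp: links_def)

lemma less_3_cases: "(k::nat) < 3 \<longleftrightarrow> k = 0 \<or> k = 1 \<or> k = 2"
  by auto

lemma vert_div: "k < 3 \<Longrightarrow> vert n k i div 4 = i"
  by (rule div_nat_eqI) (auto simp: vert_def)

lemma vert_eq_iff:
  assumes "k < 3" "l < 3"
  shows "vert n k i = vert n l j \<longleftrightarrow> i = j \<and> (k = l \<or> i = 0 \<or> i = Suc n)"
proof -
  have "vert n k i = vert n l j \<Longrightarrow> i = j"
    using vert_div assms by metis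
  then show ?thesis by (auto simp: vert_def)
qed

lemma hub_eq_iff: "hub i = hub j \<longleftrightarrow> i = j"
  by (simp add: hub_def)

lemma hub_neq_vert:
  assumes "i < n" "k < 3" shows "hub i \<noteq> vert n k j" "vert n k j \<noteq> hub i"
proof -
  have "hub i \<noteq> vert n k j"
  proof
    assume eq: "hub i = vert n k j"
    then have "j = Suc i" using vert_div[OF assms(2), of n j] by (simp add: hub_def)
    then show False using eq assms by (simp add: hub_def vert_def)
  qed
  then show "hub i \<noteq> vert n k j" "vert n k j \<noteq> hub i" by simp_all
qed

lemmas vertex_eq_simps = vert_eq_iff hub_eq_iff hub_neq_vert

text \<open>Allows edges to be replaced by their names throughout. For \<open>n = 0\<close> the
  three paths would be parallel edges between the two ends; an inner vertex on each path separates
  them.\<close>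

lemma inj_on_ends:
  assumes "n \<ge> 1" shows "inj_on (ends n) (links n)"
proof (rule inj_onI)
  fix x y assume "x \<in> links n" "y \<in> links n" "ends n x = ends n y"
  with assms show "x = y"
    by (cases x; cases y) (auto simp: doubleton_eq_iff vertex_eq_simps)
qed

lemma verts_cases:
  assumes "v \<in> verts n"
  obtains "v = vert n 0 0" | "v = vert n 0 (Suc n)" | i where "i < n" "v = hub i"
    | i k where "i < n" "k < 3" "v = vert n k (Suc i)"
proof -
  consider "v = 0" | "v = 4 * Suc n" | "4 \<le> v" "v < 4 * Suc n"
    using assms unfolding verts_def by fastforce
  then show thesis
  proof cases
    case 3
    \<comment> \<open>\<open>hub i\<close> and \<open>vert n k (Suc i)\<close> both lie in block
      \<open>Suc i\<close>, hence the subtraction of 1; it does not truncate because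
      \<open>4 \<le> v\<close>.\<close>
    define i where "i = v div 4 - 1"
    have i: "i < n" "v = 4 * Suc i + v mod 4" using 3 unfolding i_def by auto
    show thesis
    proof (cases "v mod 4 = 0")
      case True
      then show thesis using i that(3) by (simp add: hub_def)
    next
      case False
      then have "v mod 4 - 1 < 3" "v = vert n (v mod 4 - 1) (Suc i)"
        using i by (auto simp: vert_def)
      then show thesis using that(4) i(1) by blast
    qed
  qed (use that(1,2) in \<open>auto simp: vert_def\<close>)
qed

section \<open>Degrees, order and bipartition\<close>

lemma star_first: "star n (vert n 0 0) = {Path 0 0, Path 1 0, Path 2 0}"
proof (intro set_eqI)
  fix x show "x \<in> star n (vert n 0 0) \<longleftrightarrow> x \<in> {Path 0 0, Path 1 0, Path 2 0}"
    by (cases x) (auto simp: star_def vertex_eq_simps)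
qed

lemma star_last: "star n (vert n 0 (Suc n)) = {Path 0 n, Path 1 n, Path 2 n}"
proof (intro set_eqI)
  fix x show "x \<in> star n (vert n 0 (Suc n)) \<longleftrightarrow> x \<in> {Path 0 n, Path 1 n, Path 2 n}"
    by (cases x) (auto simp: star_def vertex_eq_simps)
qed

lemma star_hub:
  assumes "i < n" shows "star n (hub i) = {Rung 0 i, Rung 1 i, Rung 2 i}"
proof (intro set_eqI)
  fix x show "x \<in> star n (hub i) \<longleftrightarrow> x \<in> {Rung 0 i, Rung 1 i, Rung 2 i}"
    using assms by (cases x) (auto simp: star_def vertex_eq_simps)
qed

lemma star_inner:
  assumes "i < n" "k < 3"
  shows "star n (vert n k (Suc i)) = {Path k i, Path k (Suc i), Rung k i}"
proof (intro set_eqI)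
  fix x show "x \<in> star n (vert n k (Suc i)) \<longleftrightarrow> x \<in> {Path k i, Path k (Suc i), Rung k i}"
    using assms by (cases x) (auto simp: star_def vertex_eq_simps)
qed

lemmas star_simps = star_first star_last star_hub star_inner

lemma ends_subset: "x \<in> links n \<Longrightarrow> ends n x \<subseteq> verts n"
  by (cases x) (auto simp: hub_def vert_def verts_def)

lemma card_ends: "n \<ge> 1 \<Longrightarrow> x \<in> links n \<Longrightarrow> card (ends n x) = 2"
  by (cases x) (auto simp: vertex_eq_simps)

lemma simple_graph_edges: "n \<ge> 1 \<Longrightarrow> simple_graph (verts n) (edges n)"
  using ends_subset card_ends by (auto simp: simple_graph_def edges_def verts_def)

lemma card_verts: "card (verts n) = 4 * n + 2"
  by (simp add: verts_def)

lemma cubic_edges: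
  assumes "n \<ge> 1" shows "cubic (verts n) (edges n)"
  unfolding cubic_def
proof
  fix v assume "v \<in> verts n"
  then have "card (star n v) = 3"
    by (cases rule: verts_cases) (simp_all add: star_simps)
  moreover have "{e \<in> edges n. v \<in> e} = ends n ` star n v"
    by (auto simp: edges_def star_def)
  moreover have "inj_on (ends n) (star n v)"
    using inj_on_ends[OF assms] by (rule inj_on_subset) (auto simp: star_def)
  ultimately show "card {e \<in> edges n. v \<in> e} = 3"
    by (simp add: card_image)
qed

text \<open>The right-hand side of the inner equivalence singles out the path vertices, ends
  included. These are split by the parity of their position; a hub gets the parity opposite to its
  block, because all its neighbours lie in that block.\<close>

definition side :: "nat \<Rightarrow> nat \<Rightarrow> bool" where
  "side n v \<longleftrightarrow> (even (v div 4) \<longleftrightarrow> v = 0 \<or> v = 4 * Suc n \<or> v mod 4 \<noteq> 0)"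

lemma side_vert: "k < 3 \<Longrightarrow> side n (vert n k i) \<longleftrightarrow> even i"
  using vert_div[of k n i] by (auto simp: side_def vert_def less_3_cases)

lemma side_hub: "i < n \<Longrightarrow> side n (hub i) \<longleftrightarrow> even i"
  by (auto simp: side_def hub_def)

lemma bipartite_edges: "bipartite (verts n) (edges n)"
proof -
  have "\<exists>a\<in>{v \<in> verts n. side n v}. \<exists>b\<in>{v \<in> verts n. \<not> side n v}. ends n x = {a, b}"
    if x: "x \<in> links n" for x
  proof -
    have "\<exists>a b. ends n x = {a, b} \<and> side n a \<and> \<not> side n b"
    proof (cases x)
      case (Path k i)
      then show ?thesis
        using x side_vert[of k n i] side_vert[of k n "Suc i"] by (cases "even i") auto
    next
      case (Rung k i)
      then show ?thesis
        using x side_hub[of i n] side_vert[of k n "Suc i"]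
        by (cases "even i") auto
    qed
    then show ?thesis using ends_subset[OF x] by fastforce
  qed
  then show ?thesis
    unfolding bipartite_def edges_def
    by (intro exI[of _ "{v \<in> verts n. side n v}"] exI[of _ "{v \<in> verts n. \<not> side n v}"]) auto
qed

section \<open>The colourings determined by sets of levels\<close>

text \<open>\<open>S\<close> is the set of levels that rotate by one; the others rotate by two.\<close>

primrec shift :: "nat set \<Rightarrow> nat \<Rightarrow> nat" where
  "shift S 0 = 0"
| "shift S (Suc i) = shift S i + (if i \<in> S then 1 else 2)"

primrec colour :: "nat set \<Rightarrow> link \<Rightarrow> nat" where
  "colour S (Path k i) = (k + shift S i) mod 3"
| "colour S (Rung k i) = (k + shift S i + (if i \<in> S then 2 else 1)) mod 3"

definition colour_class :: "nat \<Rightarrow> nat set \<Rightarrow> nat \<Rightarrow> nat set set" where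
  "colour_class n S m = ends n ` {x \<in> links n. colour S x = m}"

definition colouring :: "nat \<Rightarrow> nat set \<Rightarrow> nat set set set" where
  "colouring n S = colour_class n S ` {..<3}"

lemma colour_less: "colour S x < 3"
  by (cases x) auto

lemma mod_add_middle: "(a + s mod c + b) mod c = (a + s + b) mod (c::nat)"
  by (metis mod_add_left_eq mod_add_right_eq)

lemma add_mod_3_eq_iff:
  assumes "a < 3" "b < 3" shows "(a + m) mod 3 = (b + m) mod 3 \<longleftrightarrow> a = (b::nat)"
proof -
  have "m mod 3 < 3" by simp
  then have "(a + m mod 3) mod 3 = (b + m mod 3) mod 3 \<longleftrightarrow> a = b"
    using assms unfolding less_3_cases by (elim disjE) simp_all
  then show ?thesis by (simp add: mod_simps)
qed

text \<open>At an end or a hub the path index runs through 0, 1, 2 with a fixed summand. At an inner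
  vertex the index is fixed and the incoming edge, outgoing edge and rung add 0, 1, 2 in some order.
  Either way three distinct residues appear.\<close>

lemma inj_on_colour_star:
  assumes "v \<in> verts n" shows "inj_on (colour S) (star n v)"
proof -
  have *: "(a + m) mod 3 \<noteq> (b + m) mod 3" if "a < 3" "b < 3" "a \<noteq> b" for a b m :: nat
    using add_mod_3_eq_iff that by simp
  from assms show ?thesis
  proof (cases rule: verts_cases)
    case 1
    then show ?thesis by (simp add: star_simps)
  next
    case 2
    then show ?thesis
      using *[of 0 1 "shift S n"] *[of 0 2 "shift S n"] *[of 1 2 "shift S n"]
      by (auto simp: star_simps)
  next
    case (3 i)
    show ?thesis
      using *[of 0 1] *[of 0 2] *[of 1 2] 3
      by (auto simp: star_simps add.assoc)
  next
    case (4 i k)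
    show ?thesis unfolding 4(3) star_inner[OF 4(1,2)]
      using *[of 0 1 "k + shift S i"] *[of 0 2 "k + shift S i"] *[of 1 2 "k + shift S i"]
      by (auto simp: add_ac)
  qed
qed

lemma colour_proper:
  assumes "x \<in> links n" "y \<in> links n" "x \<noteq> y" "ends n x \<inter> ends n y \<noteq> {}"
  shows "colour S x \<noteq> colour S y"
proof -
  obtain v where v: "v \<in> ends n x" "v \<in> ends n y" using assms(4) by blast
  then have "x \<in> star n v" "y \<in> star n v" "v \<in> verts n"
    using assms(1,2) ends_subset by (auto simp: star_def)
  then show ?thesis using inj_on_colour_star assms(3) by (metis inj_on_eq_iff)
qed

lemma ends_in_colour_class:
  assumes "n \<ge> 1" "x \<in> links n"
  shows "ends n x \<in> colour_class n S m \<longleftrightarrow> colour S x = m"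
  using inj_on_ends[OF assms(1)] assms(2) by (auto simp: colour_class_def dest: inj_onD)

lemma colour_class_disjoint:
  assumes "n \<ge> 1" "m \<noteq> m'"
  shows "colour_class n S m \<inter> colour_class n S m' = {}"
  using inj_on_ends[OF assms(1)] assms(2) by (auto simp: colour_class_def dest: inj_onD)

lemma colour_class_eq_iff:
  assumes "n \<ge> 1" "m < 3"
  shows "colour_class n S m = colour_class n S m' \<longleftrightarrow> m = m'"
proof -
  \<comment> \<open>Since \<open>shift S 0 = 0\<close>, the edge \<open>Path m 0\<close> has colour
    \<open>m\<close>; a nonempty class cannot equal one disjoint from it.\<close>
  have "ends n (Path m 0) \<in> colour_class n S m"
    using ends_in_colour_class[of n "Path m 0"] assms by simp
  then show ?thesis using colour_class_disjoint[OF assms(1), of m m' S] by blast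
qed

lemma colouring_in_three_edge_colorings:
  assumes "n \<ge> 1" shows "colouring n S \<in> three_edge_colorings (edges n)"
proof -
  have "\<Union>(colouring n S) = edges n"
    using colour_less by (auto simp: colouring_def edges_def colour_class_def)
  moreover have "{} \<notin> colouring n S"
  proof -
    have "ends n (Path m 0) \<in> colour_class n S m" if "m < 3" for m
      using ends_in_colour_class[OF assms, of "Path m 0"] that by simp
    then show ?thesis by (force simp: colouring_def)
  qed
  moreover have "disjoint (colouring n S)"
  proof (rule disjointI)
    fix A B assume "A \<in> colouring n S" "B \<in> colouring n S" "A \<noteq> B"
    then obtain a b where "A = colour_class n S a" "B = colour_class n S b" "a \<noteq> b"
      unfolding colouring_def by blast
    then show "A \<inter> B = {}" using colour_class_disjoint[OF assms] by simp
  qed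
  moreover have "card (colouring n S) = 3"
    unfolding colouring_def
    by (subst card_image) (auto simp: inj_on_def colour_class_eq_iff[OF assms])
  moreover have "pairwise disjnt A" if A: "A \<in> colouring n S" for A
  proof (rule pairwiseI)
    fix e f assume ef: "e \<in> A" "f \<in> A" "e \<noteq> f"
    obtain m where m: "A = ends n ` {x \<in> links n. colour S x = m}"
      using A unfolding colouring_def colour_class_def by blast
    obtain x where x: "e = ends n x" "x \<in> links n" "colour S x = m"
      using ef(1) unfolding m by blast
    obtain y where y: "f = ends n y" "y \<in> links n" "colour S y = m"
      using ef(2) unfolding m by blast
    have "x \<noteq> y" using ef(3) x(1) y(1) by blast
    then have "ends n x \<inter> ends n y = {}" using colour_proper[of x n y S] x y by metis
    then show "disjnt e f" using x y by (simp add: disjnt_def)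
  qed
  ultimately show ?thesis
    by (simp add: three_edge_colorings_def partition_on_def)
qed

text \<open>The class of \<open>Path k 0\<close> is the class of colour \<open>k\<close>, so the unlabeled classes carry names.\<close>
lemma inj_on_colouring:
  assumes "n \<ge> 1" shows "inj_on (colouring n) (Pow {..<n})"
proof (rule inj_onI)
  fix S T assume S: "S \<in> Pow {..<n}" and T: "T \<in> Pow {..<n}" and eq: "colouring n S = colouring n T"
  have cls: "colour_class n S m = colour_class n T m" if "m < 3" for m
  proof -
    have m: "Path m 0 \<in> links n" using that by simp
    have "colour_class n S m \<in> colouring n S" using that by (simp add: colouring_def)
    then obtain m' where "colour_class n S m = colour_class n T m'"
      unfolding eq by (auto simp: colouring_def)
    then show ?thesis
      using ends_in_colour_class[OF assms m, of S m] ends_in_colour_class[OF assms m, of T m'] that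
      by simp
  qed
  have col: "colour S x = colour T x" if "x \<in> links n" for x
    using cls[OF colour_less[of S x]] ends_in_colour_class[OF assms that] by metis
  have "i \<in> S \<longleftrightarrow> i \<in> T" if "i < n" for i
  proof -
    \<comment> \<open>The colours on path 0 before and after a level reveal the shifts modulo 3.
      Their difference is 1 or 2 and decides whether the level belongs to the set.\<close>
    have "shift S i mod 3 = shift T i mod 3" "shift S (Suc i) mod 3 = shift T (Suc i) mod 3"
      using col[of "Path 0 i"] col[of "Path 0 (Suc i)"] that by auto
    then have "((if i \<in> S then 1 else 2) + shift S i) mod 3 = ((if i \<in> T then 1 else 2) + shift S i) mod 3"
      by (metis add.commute mod_add_right_eq shift.simps(2))
    then show ?thesis by (simp add: add_mod_3_eq_iff split: if_splits)
  qed
  then show "S = T" using S T by blast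
qed

section \<open>Every 3-edge-coloring arises from a set of levels\<close>

lemma derangement_3:
  fixes x y z t :: nat
  assumes "t < 3" "x < 3" "y < 3" "z < 3" and "x \<noteq> y" "x \<noteq> z" "y \<noteq> z"
    and "x \<noteq> t mod 3" "y \<noteq> (1 + t) mod 3" "z \<noteq> (2 + t) mod 3"
  shows "x = (t + 1) mod 3 \<and> y = (1 + t + 1) mod 3 \<and> z = (2 + t + 1) mod 3 \<or>
    x = (t + 2) mod 3 \<and> y = (1 + t + 2) mod 3 \<and> z = (2 + t + 2) mod 3"
proof -
  \<comment> \<open>The only derangements of three objects are the two 3-cycles; this is checked by
    enumerating all residues.\<close>
  have "\<forall>t\<in>{0,1,2}. \<forall>x\<in>{0,1,2}. \<forall>y\<in>{0,1,2}. \<forall>z\<in>{0,1,2::nat}.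
      x \<noteq> y \<and> x \<noteq> z \<and> y \<noteq> z \<and> x \<noteq> t mod 3 \<and> y \<noteq> (1 + t) mod 3 \<and> z \<noteq> (2 + t) mod 3 \<longrightarrow>
      x = (t + 1) mod 3 \<and> y = (1 + t + 1) mod 3 \<and> z = (2 + t + 1) mod 3 \<or>
      x = (t + 2) mod 3 \<and> y = (1 + t + 2) mod 3 \<and> z = (2 + t + 2) mod 3"
    by simp
  then show ?thesis using assms unfolding less_3_cases by blast
qed

text \<open>The rungs at a level are coloured by a derangement of the colours of the incoming path edges,
  hence by one of the two rotations; the outgoing path edges get the other one.\<close>
lemma rotation_step:
  fixes p q r :: "nat \<Rightarrow> nat"
  assumes p: "\<And>k. k < 3 \<Longrightarrow> p k = (k + s) mod 3"
    and less: "\<And>k. k < 3 \<Longrightarrow> q k < 3 \<and> r k < 3"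
    and inj: "r 0 \<noteq> r 1" "r 0 \<noteq> r 2" "r 1 \<noteq> r 2"
    and ne: "\<And>k. k < 3 \<Longrightarrow> p k \<noteq> q k \<and> p k \<noteq> r k \<and> q k \<noteq> r k"
    and "k < 3"
  shows "q k = (k + s + (if q 0 = (s + 1) mod 3 then 1 else 2)) mod 3 \<and>
    r k = (k + s + (if q 0 = (s + 1) mod 3 then 2 else 1)) mod 3"
proof -
  \<comment> \<open>Reducing \<open>s\<close> to a residue makes the finite case checks
    applicable.\<close>
  define t where "t = s mod 3"
  have t: "t < 3" unfolding t_def by simp
  have mod_t: "(s + l) mod 3 = (t + l) mod 3" "(j + s + l) mod 3 = (j + t + l) mod 3" for j l
    by (simp_all add: t_def mod_simps mod_add_middle)
  have p_t: "p j = (j + t) mod 3" if "j < 3" for j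
    using p[OF that] by (simp add: t_def mod_simps)
  have r_cases: "(\<forall>j<3. r j = (j + t + 1) mod 3) \<or> (\<forall>j<3. r j = (j + t + 2) mod 3)"
  proof -
    have "r 0 \<noteq> t mod 3" "r 1 \<noteq> (1 + t) mod 3" "r 2 \<noteq> (2 + t) mod 3"
      using ne[of 0] ne[of 1] ne[of 2] p_t[of 0] p_t[of 1] p_t[of 2] by auto
    then have "r 0 = (0 + t + 1) mod 3 \<and> r 1 = (1 + t + 1) mod 3 \<and> r 2 = (2 + t + 1) mod 3 \<or>
        r 0 = (0 + t + 2) mod 3 \<and> r 1 = (1 + t + 2) mod 3 \<and> r 2 = (2 + t + 2) mod 3"
      using derangement_3[OF t _ _ _ inj] less[of 0] less[of 1] less[of 2] by simp
    then show ?thesis unfolding less_3_cases by blast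
  qed
  \<comment> \<open>The colours 0, 1, 2 add up to 3, so two of them determine the third by
    subtraction.\<close>
  have third: "a = 3 - b - c" if "a < 3" "b < 3" "c < 3" "b \<noteq> a" "b \<noteq> c" "a \<noteq> c" for a b c :: nat
    using that by linarith
  have q: "q j = 3 - (j + t) mod 3 - r j" if "j < 3" for j
    using third[of "q j" "p j" "r j"] less[OF that] ne[OF that] p_t[OF that] by simp
  have complement: "3 - (j + t) mod 3 - (j + t + 1) mod 3 = (j + t + 2) mod 3"
    "3 - (j + t) mod 3 - (j + t + 2) mod 3 = (j + t + 1) mod 3" if "j < 3" for j
  proof -
    have "\<forall>j\<in>{0,1,2}. \<forall>t\<in>{0,1,2::nat}. 3 - (j + t) mod 3 - (j + t + 1) mod 3 = (j + t + 2) mod 3 \<and>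
        3 - (j + t) mod 3 - (j + t + 2) mod 3 = (j + t + 1) mod 3"
      by simp
    then show "3 - (j + t) mod 3 - (j + t + 1) mod 3 = (j + t + 2) mod 3"
      "3 - (j + t) mod 3 - (j + t + 2) mod 3 = (j + t + 1) mod 3"
      using that t unfolding less_3_cases by blast+
  qed
  \<comment> \<open>When the rungs rotate by one, path 0 leaves the level with
    \<open>(t + 2) mod 3\<close>; this must make the test on \<open>q 0\<close> fail.\<close>
  have distinct: "(t + 2) mod 3 \<noteq> (t + 1) mod 3"
    using add_mod_3_eq_iff[of 2 1 t] by (simp add: add.commute)
  from r_cases show ?thesis
  proof
    assume r: "\<forall>j<3. r j = (j + t + 1) mod 3"
    have "q j = (j + t + 2) mod 3" if "j < 3" for j
      using q[OF that] r complement(1)[OF that] that by simp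
    from this[of 0] this[OF \<open>k < 3\<close>] show ?thesis
      using r \<open>k < 3\<close> distinct unfolding mod_t by simp
  next
    assume r: "\<forall>j<3. r j = (j + t + 2) mod 3"
    have "q j = (j + t + 1) mod 3" if "j < 3" for j
      using q[OF that] r complement(2)[OF that] that by simp
    from this[of 0] this[OF \<open>k < 3\<close>] show ?thesis
      using r \<open>k < 3\<close> unfolding mod_t by simp
  qed
qed

text \<open>The classes are named by the three edges at vertex 0. From there the names propagate
  level by level, each level leaving only the choice between the two rotations of
  \<open>rotation_step\<close>.\<close>

lemma three_edge_coloring_eq_colouring:
  assumes n: "n \<ge> 1" and P: "P \<in> three_edge_colorings (edges n)"
  obtains S where "S \<subseteq> {..<n}" "P = colouring n S"
proof -
  have part: "partition_on (edges n) P" and c3: "card P = 3"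
    and proper: "\<And>A. A \<in> P \<Longrightarrow> pairwise disjnt A"
    using P by (auto simp: three_edge_colorings_def)
  have adj: "\<not> (ends n x \<in> A \<and> ends n y \<in> A)"
    if "A \<in> P" "x \<in> links n" "y \<in> links n" "x \<noteq> y" "v \<in> ends n x" "v \<in> ends n y" for A x y v
    using proper[OF that(1)] inj_onD[OF inj_on_ends[OF n], of x y] that
    by (auto simp: pairwise_def disjnt_def)
  have ex: "\<exists>A\<in>P. ends n x \<in> A" if "x \<in> links n" for x
    using part that by (auto simp: partition_on_def edges_def)
  obtain A where A: "\<And>k. k < 3 \<Longrightarrow> A k \<in> P \<and> ends n (Path k 0) \<in> A k"
  proof -
    have "\<forall>k. \<exists>A. k < 3 \<longrightarrow> A \<in> P \<and> ends n (Path k 0) \<in> A"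
      using ex by (metis Path_in_links le0)
    then show thesis using that by metis
  qed
  \<comment> \<open>The edges \<open>Path k 0\<close> share vertex 0, so they lie in different
    classes; as \<open>card P = 3\<close>, these are all the classes.\<close>
  have "A k \<noteq> A l" if "k < 3" "l < 3" "k \<noteq> l" for k l
    using adj[of "A k" "Path k 0" "Path l 0" 0] A that by (auto simp: vert_def)
  then have injA: "inj_on A {..<3}" by (auto simp: inj_on_def)
  have AP: "A ` {..<3} = P"
    using A c3 card_image[OF injA]
    by (intro card_subset_eq) (auto simp: card_ge_0_finite)
  define c where "c x = (THE k. k < 3 \<and> ends n x \<in> A k)" for x
  have uniq: "k = l" if "k < 3" "l < 3" "e \<in> A k" "e \<in> A l" for k l e
    using disjointD[OF partition_onD2[OF part], of "A k" "A l"] A that inj_onD[OF injA, of k l] by auto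
  have c: "c x < 3 \<and> ends n x \<in> A (c x)" if x: "x \<in> links n" for x
    unfolding c_def
  proof (rule theI')
    obtain k where "k < 3" "ends n x \<in> A k" using ex[OF x] AP by auto
    then show "\<exists>!k. k < 3 \<and> ends n x \<in> A k" using uniq by blast
  qed
  have cI: "c x = k" if "x \<in> links n" "k < 3" "ends n x \<in> A k" for x k
    using c[OF that(1)] uniq that by blast
  have cne: "c x \<noteq> c y" if "x \<in> links n" "y \<in> links n" "x \<noteq> y" "v \<in> ends n x" "v \<in> ends n y" for x y v
    using adj[of "A (c x)" x y v] c[OF that(1)] c[OF that(2)] A that by auto
  \<comment> \<open>Looking at path 0 is enough, since all three paths rotate by the same amount at
    a level.\<close>
  define S where "S = {i. i < n \<and> c (Path 0 (Suc i)) = (c (Path 0 i) + 1) mod 3}"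
  have step: "c (Path k (Suc i)) = colour S (Path k (Suc i)) \<and> c (Rung k i) = colour S (Rung k i)"
    if i: "i < n" and IH: "\<And>k. k < 3 \<Longrightarrow> c (Path k i) = colour S (Path k i)" and "k < 3" for i k
  proof -
    have less: "c (Path k (Suc i)) < 3 \<and> c (Rung k i) < 3" if "k < 3" for k
      using c[of "Path k (Suc i)"] c[of "Rung k i"] that i by simp
    have hub: "c (Rung k i) \<noteq> c (Rung l i)" if "k < 3" "l < 3" "k \<noteq> l" for k l
      using cne[of "Rung k i" "Rung l i" "hub i"] that i by simp
    have inner: "c (Path k i) \<noteq> c (Path k (Suc i)) \<and> c (Path k i) \<noteq> c (Rung k i) \<and>
        c (Path k (Suc i)) \<noteq> c (Rung k i)" if "k < 3" for k
      using that i cne[of "Path k i" "Path k (Suc i)" "vert n k (Suc i)"]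
        cne[of "Path k i" "Rung k i" "vert n k (Suc i)"]
        cne[of "Path k (Suc i)" "Rung k i" "vert n k (Suc i)"] by simp
    \<comment> \<open>Puts membership in \<open>S\<close> into the form of the test in
      \<open>rotation_step\<close>.\<close>
    have mem: "i \<in> S \<longleftrightarrow> c (Path 0 (Suc i)) = (shift S i + 1) mod 3"
      using IH[of 0] i by (simp add: S_def mod_simps)
    have "c (Path k (Suc i)) = (k + shift S i + (if i \<in> S then 1 else 2)) mod 3 \<and>
        c (Rung k i) = (k + shift S i + (if i \<in> S then 2 else 1)) mod 3"
      unfolding mem
      by (rule rotation_step[of "\<lambda>k. c (Path k i)"])
        (use IH less hub inner \<open>k < 3\<close> in simp_all)
    then show ?thesis by (simp add: add.assoc)
  qed
  have path: "i \<le> n \<Longrightarrow> k < 3 \<Longrightarrow> c (Path k i) = colour S (Path k i)" for i k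
  proof (induction i arbitrary: k)
    case 0
    then show ?case using A[of k] cI[of "Path k 0" k] by simp
  next
    case (Suc i)
    then show ?case using step[of i k] by simp
  qed
  have col: "c x = colour S x" if "x \<in> links n" for x
    using that path step by (cases x) auto
  have "A m = colour_class n S m" if "m < 3" for m
  proof -
    have "A m \<subseteq> edges n" using part A[OF that] by (auto simp: partition_on_def)
    then have "A m = ends n ` {x \<in> links n. c x = m}"
      using cI[OF _ that] c by (auto simp: edges_def)
    then show ?thesis using col by (auto simp: colour_class_def)
  qed
  then have "P = colouring n S" using AP by (auto simp: colouring_def)
  moreover have "S \<subseteq> {..<n}" by (auto simp: S_def)
  ultimately show thesis using that by blast
qed

lemma card_three_edge_colorings:
  assumes "n \<ge> 1" shows "card (three_edge_colorings (edges n)) = 2 ^ n"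
proof -
  have "three_edge_colorings (edges n) = colouring n ` Pow {..<n}"
    using three_edge_coloring_eq_colouring[OF assms] colouring_in_three_edge_colorings[OF assms]
    by blast
  then show ?thesis
    using card_image[OF inj_on_colouring[OF assms]] by (simp add: card_Pow)
qed

section \<open>Kempe switches leave every coloring unchanged\<close>

text \<open>Two strands avoid colour \<open>m\<close> at each level: one goes straight on to the next level and the
  other crosses over through the hub. They meet at the vertex \<open>vert n 0 0\<close>, so a property closed
  under adjacency is constant along both.\<close>
lemma two_coloured_connected:
  assumes "m < 3"
    and closed: "\<And>x y v. x \<in> links n \<Longrightarrow> y \<in> links n \<Longrightarrow> colour S x \<noteq> m \<Longrightarrow> colour S y \<noteq> m \<Longrightarrow>
      v \<in> ends n x \<Longrightarrow> v \<in> ends n y \<Longrightarrow> D x \<longleftrightarrow> D y"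
  obtains b where "\<And>x. x \<in> links n \<Longrightarrow> colour S x \<noteq> m \<Longrightarrow> D x \<longleftrightarrow> b"
proof -
  \<comment> \<open>The common value of \<open>D\<close> on the two edges at vertex 0 that avoid
    \<open>m\<close>; they agree by \<open>closed\<close>.\<close>
  define b where "b \<longleftrightarrow> (\<exists>k<3. colour S (Path k 0) \<noteq> m \<and> D (Path k 0))"
  have step: "(colour S (Path k (Suc i)) \<noteq> m \<longrightarrow> (D (Path k (Suc i)) \<longleftrightarrow> b)) \<and>
      (colour S (Rung k i) \<noteq> m \<longrightarrow> (D (Rung k i) \<longleftrightarrow> b))"
    if i: "i < n" and IH: "\<And>k. k < 3 \<Longrightarrow> colour S (Path k i) \<noteq> m \<Longrightarrow> D (Path k i) \<longleftrightarrow> b" and k: "k < 3"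
    for i k
  proof -
    have distinct: "colour S (Path k i) \<noteq> colour S (Path k (Suc i))"
      "colour S (Path k i) \<noteq> colour S (Rung k i)" "colour S (Path k (Suc i)) \<noteq> colour S (Rung k i)"
      if "k < 3" for k
      using that i colour_proper[of "Path k i" n "Path k (Suc i)" S]
        colour_proper[of "Path k i" n "Rung k i" S]
        colour_proper[of "Path k (Suc i)" n "Rung k i" S] by auto
    have inner: "colour S (Path k i) \<noteq> m \<Longrightarrow> colour S (Path k (Suc i)) \<noteq> m \<Longrightarrow> D (Path k (Suc i)) \<longleftrightarrow> D (Path k i)"
      "colour S (Path k i) \<noteq> m \<Longrightarrow> colour S (Rung k i) \<noteq> m \<Longrightarrow> D (Rung k i) \<longleftrightarrow> D (Path k i)"
      "colour S (Path k (Suc i)) \<noteq> m \<Longrightarrow> colour S (Rung k i) \<noteq> m \<Longrightarrow> D (Path k (Suc i)) \<longleftrightarrow> D (Rung k i)"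
      if "k < 3" for k
      by (rule closed[where v = "vert n k (Suc i)"]; use that i in simp)+
    show ?thesis
    proof (cases "colour S (Path k i) = m")
      case False
      then show ?thesis using inner(1,2)[OF k] IH[OF k] by blast
    next
      case True
      \<comment> \<open>\<open>l\<close> is the path whose outgoing edge has colour
        \<open>m\<close>. It solves \<open>l + shift S (Suc i) = m\<close> modulo 3, with
        \<open>2\<close> in place of \<open>-1\<close> to stay within the natural numbers.\<close>
      define l where "l = (m + 2 * shift S (Suc i)) mod 3"
      have l: "l < 3" "colour S (Path l (Suc i)) = m"
      proof -
        have "m + 2 * shift S (Suc i) + shift S (Suc i) = m + shift S (Suc i) * 3" by simp
        then show "colour S (Path l (Suc i)) = m"
          using \<open>m < 3\<close> unfolding l_def colour.simps mod_add_left_eq by (metis mod_less mod_mult_self1)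
      qed (simp add: l_def)
      \<comment> \<open>Path \<open>k\<close> is blocked before the level and path \<open>l\<close>
        after it. Both rungs avoid \<open>m\<close>, so the strand arriving on \<open>l\<close>
        passes through the hub and leaves on \<open>k\<close>.\<close>
      have rungs: "colour S (Rung k i) \<noteq> m" "colour S (Rung l i) \<noteq> m" "colour S (Path l i) \<noteq> m"
        using distinct[OF k] distinct[OF l(1)] True l(2) by metis+
      have "D (Rung k i) \<longleftrightarrow> D (Rung l i)"
        using closed[of "Rung k i" "Rung l i" "hub i"] rungs i k l(1) by simp
      then have "D (Rung k i) \<longleftrightarrow> b"
        using inner(2)[OF l(1)] IH[OF l(1)] rungs by blast
      then show ?thesis using inner(3)[OF k] rungs(1) by blast
    qed
  qed
  have path: "i \<le> n \<Longrightarrow> k < 3 \<Longrightarrow> colour S (Path k i) \<noteq> m \<Longrightarrow> D (Path k i) \<longleftrightarrow> b" for i k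
  proof (induction i arbitrary: k)
    case 0
    have "D (Path k 0) \<longleftrightarrow> D (Path l 0)" if "l < 3" "colour S (Path l 0) \<noteq> m" for l
      using closed[of "Path k 0" "Path l 0" 0] 0 that by (simp add: vert_def)
    then show ?case using 0 unfolding b_def by blast
  next
    case (Suc i)
    then show ?case using step[of i k] by simp
  qed
  have "D x \<longleftrightarrow> b" if "x \<in> links n" "colour S x \<noteq> m" for x
    using that path step by (cases x) auto
  then show thesis by (rule that)
qed

lemma kempe_switch_trivial:
  assumes n: "n \<ge> 1" and "(P, Q) \<in> kempe_switch (edges n)"
  shows "Q = P"
proof -
  obtain A B C where P: "P \<in> three_edge_colorings (edges n)"
    and AB: "A \<in> P" "B \<in> P" "A \<noteq> B" and C: "is_cycle C" "C \<subseteq> A \<union> B"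
    and Q: "Q = (P - {A, B}) \<union> {(A - C) \<union> (B \<inter> C), (B - C) \<union> (A \<inter> C)}"
    using assms(2) unfolding kempe_switch_def by blast
  obtain S where S: "P = colouring n S" using three_edge_coloring_eq_colouring[OF n P] .
  have proper: "pairwise disjnt A" "pairwise disjnt B"
    using P AB by (auto simp: three_edge_colorings_def)
  obtain a b where ab: "a < 3" "A = colour_class n S a" "b < 3" "B = colour_class n S b" "a \<noteq> b"
    using AB unfolding S colouring_def by auto
  \<comment> \<open>The third colour, as 0, 1 and 2 sum to 3.\<close>
  define m where "m = 3 - a - b"
  have m: "m < 3" "\<And>l. l < 3 \<Longrightarrow> l \<noteq> m \<longleftrightarrow> l = a \<or> l = b"
    using ab(1,3,5) unfolding m_def less_3_cases by auto
  have un: "A \<union> B = ends n ` {x \<in> links n. colour S x \<noteq> m}"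
    using m(2)[OF colour_less] ab by (auto simp: colour_class_def)
  have closed: "ends n x \<in> C \<longleftrightarrow> ends n y \<in> C"
    if "x \<in> links n" "y \<in> links n" "colour S x \<noteq> m" "colour S y \<noteq> m" "v \<in> ends n x" "v \<in> ends n y"
    for x y v
    using cycle_closed[OF C proper, of "ends n x" "ends n y"]
      cycle_closed[OF C proper, of "ends n y" "ends n x"] that un by blast
  obtain t where t: "\<And>x. x \<in> links n \<Longrightarrow> colour S x \<noteq> m \<Longrightarrow> ends n x \<in> C \<longleftrightarrow> t"
  proof (rule two_coloured_connected[where D = "\<lambda>x. ends n x \<in> C", OF m(1)])
    show "ends n x \<in> C \<longleftrightarrow> ends n y \<in> C"
      if "x \<in> links n" "y \<in> links n" "colour S x \<noteq> m" "colour S y \<noteq> m" "v \<in> ends n x" "v \<in> ends n y"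
      for x y v using closed[OF that] .
  qed (use that in blast)
  \<comment> \<open>Membership in \<open>C\<close> is constant on \<open>A \<union> B\<close>; one
    edge of the cycle makes it constantly true, so \<open>C\<close> is the whole union and the
    switch merely exchanges \<open>A\<close> and \<open>B\<close>.\<close>
  obtain e where "e \<in> C" using cycle_nonempty[OF C(1)] by blast
  then have t using t C(2) unfolding un by blast
  then have "A \<union> B \<subseteq> C" using t unfolding un by blast
  then have "C = A \<union> B" using C(2) by blast
  then have "(A - C) \<union> (B \<inter> C) = B" "(B - C) \<union> (A \<inter> C) = A" by auto
  then show ?thesis using Q AB by auto
qed

lemma card_kempe_classes:
  assumes "n \<ge> 1" shows "card (kempe_classes (edges n)) = 2 ^ n"
proof -
  have "P = Q" if "(P, Q) \<in> (kempe_switch (edges n))\<^sup>*" for P Q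
    using that by induction (use kempe_switch_trivial[OF assms] in auto)
  then have "kempe_equiv (edges n) = Id_on (three_edge_colorings (edges n))"
    by (auto simp: kempe_equiv_def)
  then have "kempe_classes (edges n) = (\<lambda>P. {P}) ` three_edge_colorings (edges n)"
    by (auto simp: kempe_classes_def quotient_def)
  then show ?thesis
    using card_three_edge_colorings[OF assms] by (simp add: card_image)
qed

theorem theorem5:
  fixes n :: nat
  assumes "n \<ge> 1"
  shows "\<exists>(V :: nat set) E. simple_graph V E \<and> bipartite V E \<and> cubic V E \<and>
           card V = 4 * n + 2 \<and> card (kempe_classes E) = 2 ^ n"
  using simple_graph_edges[OF assms] bipartite_edges cubic_edges[OF assms] card_verts
    card_kempe_classes[OF assms]
  by blast

end
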